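(* Let $PWP$ denote the partial Wiener polynomial of a rooted tree with respect to its root (a polynomial in $x$), and write $PWP(n)=PWP(\tau(n))$, where $\tau(n)$ is the rooted tree with Matula number $n$. Then for every positive integer $n$, $$PWP(n)=\begin{cases}0, & \text{if } n=1;\\ x+x\,PWP(t), & \text{if } n=p_t \text{ with } t\ge 1;\\ PWP(r)+PWP(s), & \text{if } n=rs \text{ with } r,s\ge 2.\end{cases}$$
   Context: For $m\ge 1$ let $p_m$ denote the $m$-th prime ($p_1=2,p_2=3,p_3=5,\dots$). Rooted trees are finite and considered up to isomorphism of rooted trees. The Matula number $\mu(T)$ of a rooted tree $T$ is defined recursively: $\mu(T)=1$ for the one-vertex tree; otherwise, if $T_1,\dots,T_d$ are the subtrees rooted at the vertices adjacent to the root of $T$, then $\mu(T)=p_{\mu(T_1)}p_{\mu(T_2)}\cdots p_{\mu(T_d)}$. The map $\mu$ is a bijection from rooted trees to positive integers, and $\tau(n)$ denotes the rooted tree with Matula number $n$. Equivalently: $\tau(1)$ is the one-vertex tree; $\tau(p_t)$ is obtained from $\tau(t)$ by adding a new vertex, which becomes the root, joined by an edge to the root of $\tau(t)$; and, for $r,s\ge 2$, $\tau(rs)$ is obtained from $\tau(r)$ and $\tau(s)$ by identifying their roots. For a statistic $S$ on rooted trees, $S(n)$ means $S(\tau(n))$. The partial Wiener polynomial of a tree $T$ with respect to a vertex $w$ is $\sum_i x^{d(i,w)}$, where the sum is over all vertices $i$ of $T$ distinct from $w$ and $d(i,w)$ is the distance in $T$. *)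

theory Defs
  imports "HOL-Computational_Algebra.Computational_Algebra" "HOL-Library.Infinite_Set"
begin

text \<open>\<^const>\<open>enumerate\<close> counts from \<open>0\<close>, whereas \<open>p\<^sub>1 = 2\<close>. Only \<open>m \<ge> 1\<close> is meaningful.\<close>

definition nth_prime :: "nat \<Rightarrow> nat" where
  "nth_prime m = enumerate {p. prime p} (m - 1)"

text \<open>A simple graph with a distinguished vertex; an undirected edge between \<open>u\<close> and \<open>v\<close> is stored
  as both \<open>(u, v)\<close> and \<open>(v, u)\<close>.\<close>

record 'a rooted_graph =
  verts :: "'a set"
  edges :: "('a \<times> 'a) set"
  root :: 'a

definition is_cycle :: "('a \<times> 'a) set \<Rightarrow> 'a list \<Rightarrow> bool" where
  "is_cycle E c \<longleftrightarrow> length c \<ge> 3 \<and> distinct c \<and>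
     (\<forall>i. Suc i < length c \<longrightarrow> (c ! i, c ! Suc i) \<in> E) \<and> (last c, hd c) \<in> E"

definition rooted_tree :: "'a rooted_graph \<Rightarrow> bool" where
  "rooted_tree T \<longleftrightarrow>
     finite (verts T) \<and> root T \<in> verts T \<and>
     edges T \<subseteq> verts T \<times> verts T \<and> sym (edges T) \<and> irrefl (edges T) \<and>
     (\<forall>u\<in>verts T. \<forall>v\<in>verts T. (u, v) \<in> (edges T)\<^sup>*) \<and>
     (\<nexists>c. is_cycle (edges T) c)"

definition children :: "'a rooted_graph \<Rightarrow> 'a set" where
  "children T = {v. (root T, v) \<in> edges T}"

definition edges_minus_root :: "'a rooted_graph \<Rightarrow> ('a \<times> 'a) set" where
  "edges_minus_root T = {(u, w) \<in> edges T. u \<noteq> root T \<and> w \<noteq> root T}"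

text \<open>The subtree rooted at a child \<open>v\<close> of the root: the connected component of \<open>v\<close> after deleting
  the root.\<close>

definition subtree :: "'a rooted_graph \<Rightarrow> 'a \<Rightarrow> 'a rooted_graph" where
  "subtree T v =
     (let W = {w. (v, w) \<in> (edges_minus_root T)\<^sup>*}
      in \<lparr>verts = W, edges = edges_minus_root T \<inter> (W \<times> W), root = v\<rparr>)"

lemma card_verts_subtree_less:
  assumes T: "rooted_tree T" and v: "v \<in> children T"
  shows "card (verts (subtree T v)) < card (verts T)"
proof -
  have v': "v \<in> verts T" "v \<noteq> root T"
    using T v by (auto simp: rooted_tree_def children_def irrefl_def)
  have "w \<in> verts T - {root T}" if "(v, w) \<in> (edges_minus_root T)\<^sup>*" for w
    using that
  proof (induction rule: rtrancl_induct)
    case base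
    then show ?case using v' by simp
  next
    case (step y z)
    then show ?case using T by (auto simp: rooted_tree_def edges_minus_root_def)
  qed
  hence "verts (subtree T v) \<subseteq> verts T - {root T}"
    by (auto simp: subtree_def Let_def)
  hence "verts (subtree T v) \<subset> verts T"
    using T by (auto simp: rooted_tree_def)
  thus ?thesis
    using T by (intro psubset_card_mono) (auto simp: rooted_tree_def)
qed

text \<open>The one-vertex tree gets the empty product \<open>1\<close>. Graphs that are not rooted trees get the dummy
  value \<open>0\<close>.\<close>

function matula :: "'a rooted_graph \<Rightarrow> nat" where
  "matula T =
     (if rooted_tree T then \<Prod>v\<in>children T. nth_prime (matula (subtree T v)) else 0)"
  by auto
termination
  by (relation "measure (\<lambda>T. card (verts T))") (auto intro: card_verts_subtree_less)

declare matula.simps [simp del]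

text \<open>The rooted tree with Matula number \<open>n\<close>. Rooted trees with the same Matula number are isomorphic,
  so \<open>\<tau> n\<close> is a representative of the isomorphism class in question; every finite rooted tree has an
  isomorphic copy with vertices in \<^typ>\<open>nat\<close>.\<close>

definition \<tau> :: "nat \<Rightarrow> nat rooted_graph" where
  "\<tau> n = (SOME T. rooted_tree T \<and> matula T = n)"

text \<open>\<open>E ^^ k\<close> relates the endpoints of the walks of length \<open>k\<close>.\<close>

definition distance :: "('a \<times> 'a) set \<Rightarrow> 'a \<Rightarrow> 'a \<Rightarrow> nat" where
  "distance E u v = (LEAST k. (u, v) \<in> E ^^ k)"

definition partial_wiener_poly :: "'a set \<Rightarrow> ('a \<times> 'a) set \<Rightarrow> 'a \<Rightarrow> int poly" where
  "partial_wiener_poly V E w = (\<Sum>i\<in>V - {w}. monom 1 (distance E i w))"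

definition PWP_tree :: "'a rooted_graph \<Rightarrow> int poly" where
  "PWP_tree T = partial_wiener_poly (verts T) (edges T) (root T)"

definition PWP :: "nat \<Rightarrow> int poly" where
  "PWP n = PWP_tree (\<tau> n)"

end

theory Submission
  imports Defs "HOL-Library.Countable"
begin

text \<open>
  The polynomial of a rooted tree is determined by its branches. Every non-root vertex lies in the
  subtree of exactly one child \<open>v\<close> of the root, and it is one step farther from the root than from
  \<open>v\<close>. So a child \<open>v\<close> contributes \<open>x\<close> for itself and \<open>x\<close> times the polynomial of its
  subtree for its proper descendants (\<open>PWP_tree_eq_sum_children\<close>).

  The Matula number has the same shape with products for sums: a child with subtree \<open>S\<close>
  contributes the prime factor with index \<open>matula S\<close>. By unique factorization the indices of the
  prime factors of \<open>matula T\<close> are therefore the Matula numbers of the branches, and the polynomial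
  is a function of the Matula number alone: the completely additive function \<open>arith_PWP\<close> whose
  value at the \<open>t\<close>-th prime is \<open>x\<close> plus \<open>x\<close> times its value at \<open>t\<close>
  (\<open>PWP_tree_eq_arith_PWP\<close>). The three cases of the recurrence are immediate for this function.

  It remains to know that \<open>\<tau> n\<close> really has Matula number \<open>n\<close>, that is, that every positive
  integer is a Matula number (\<open>matula_surj\<close>). Given trees whose Matula numbers are the indices of
  the prime factors of \<open>n\<close>, one hangs them below a new root. That the branches of the resulting
  tree have the expected Matula numbers, and that its vertices may be renamed to natural numbers,
  both follow from the invariance of Matula numbers under injective renaming of vertices.
\<close>

section \<open>Cycles and paths\<close>

lemma is_cycle_successively:
  "is_cycle E c \<longleftrightarrow> 3 \<le> length c \<and> distinct c \<and>
     successively (\<lambda>u v. (u, v) \<in> E) c \<and> (last c, hd c) \<in> E"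
  by (auto simp: is_cycle_def successively_conv_nth)

lemma is_cycle_mono: "is_cycle E c \<Longrightarrow> E \<subseteq> E' \<Longrightarrow> is_cycle E' c"
  by (auto simp: is_cycle_def)

lemma is_cycle_rotate:
  assumes "is_cycle E (xs @ ys)"
  shows "is_cycle E (ys @ xs)"
proof (cases "xs = [] \<or> ys = []")
  case True
  then show ?thesis using assms by auto
next
  case False
  then show ?thesis
    using assms
    by (simp add: is_cycle_successively successively_append_iff Int_commute add.commute)
qed

text \<open>Whenever a walk is about to return to a vertex of the path built so far, the path is cut back to
  that vertex.\<close>

lemma rtrancl_imp_distinct_path:
  assumes "(u, v) \<in> E\<^sup>*"
  obtains p where "p \<noteq> []" "hd p = u" "last p = v" "distinct p"
    "successively (\<lambda>x y. (x, y) \<in> E) p"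
  using assms
proof (induction arbitrary: thesis rule: rtrancl_induct)
  case base
  show ?case by (rule base[of "[u]"]) auto
next
  case (step y z)
  obtain p where p: "p \<noteq> []" "hd p = u" "last p = y" "distinct p"
    "successively (\<lambda>x y. (x, y) \<in> E) p"
    using step.IH by blast
  show ?case
  proof (cases "z \<in> set p")
    case True
    then obtain xs ys where "p = xs @ z # ys"
      by (meson split_list)
    with p show ?thesis
      by (intro step.prems[of "xs @ [z]"])
         (auto simp: successively_append_iff hd_append split: if_splits)
  next
    case False
    with p step.hyps show ?thesis
      by (intro step.prems[of "p @ [z]"]) (auto simp: successively_append_iff)
  qed
qed

section \<open>The branches of a rooted tree\<close>

lemma sym_edges_minus_root: "rooted_tree T \<Longrightarrow> sym (edges_minus_root T)"
  by (auto simp: rooted_tree_def edges_minus_root_def sym_def)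

lemma edges_minus_root_subset: "edges_minus_root T \<subseteq> edges T"
  by (auto simp: edges_minus_root_def)

lemma children_subset: "rooted_tree T \<Longrightarrow> children T \<subseteq> verts T - {root T}"
  by (auto simp: rooted_tree_def children_def irrefl_def)

lemma finite_children: "rooted_tree T \<Longrightarrow> finite (children T)"
  by (rule finite_subset[OF children_subset]) (auto simp: rooted_tree_def)

lemma mem_verts_subtree: "w \<in> verts (subtree T v) \<longleftrightarrow> (v, w) \<in> (edges_minus_root T)\<^sup>*"
  by (simp add: subtree_def Let_def)

lemma root_subtree [simp]: "root (subtree T v) = v"
  by (simp add: subtree_def Let_def)

lemma edges_subtree:
  "edges (subtree T v) = edges_minus_root T \<inter> (verts (subtree T v) \<times> verts (subtree T v))"
  by (simp add: subtree_def Let_def)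

lemma verts_subtree_subset:
  assumes T: "rooted_tree T" and v: "v \<in> children T"
  shows "verts (subtree T v) \<subseteq> verts T - {root T}"
proof
  fix w assume "w \<in> verts (subtree T v)"
  hence "(v, w) \<in> (edges_minus_root T)\<^sup>*" by (simp add: mem_verts_subtree)
  thus "w \<in> verts T - {root T}"
  proof (induction rule: rtrancl_induct)
    case base
    then show ?case using children_subset[OF T] v by auto
  next
    case (step y z)
    then show ?case using T by (auto simp: rooted_tree_def edges_minus_root_def)
  qed
qed

text \<open>A branch is a connected component of the tree without its root, so walks that avoid the root and
  start in the branch never leave it. Length is kept, as it is needed for distances.\<close>

lemma relpow_edges_subtree:
  assumes "(u, w) \<in> edges_minus_root T ^^ k" "u \<in> verts (subtree T v)"
  shows "(u, w) \<in> edges (subtree T v) ^^ k \<and> w \<in> verts (subtree T v)"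
  using assms
proof (induction k arbitrary: w)
  case 0
  then show ?case by simp
next
  case (Suc k)
  then obtain y where y: "(u, y) \<in> edges_minus_root T ^^ k" "(y, w) \<in> edges_minus_root T"
    by auto
  with Suc have IH: "(u, y) \<in> edges (subtree T v) ^^ k" "y \<in> verts (subtree T v)"
    by auto
  moreover from this y have "w \<in> verts (subtree T v)"
    by (auto simp: mem_verts_subtree)
  ultimately show ?case
    using y by (auto simp: edges_subtree)
qed

lemma rooted_tree_subtree:
  assumes T: "rooted_tree T" and v: "v \<in> children T"
  shows "rooted_tree (subtree T v)"
proof -
  let ?S = "subtree T v"
  have sym: "sym (edges ?S)"
    using sym_edges_minus_root[OF T] by (auto simp: sym_def edges_subtree)
  have reach: "(v, w) \<in> (edges ?S)\<^sup>*" if "w \<in> verts ?S" for w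
  proof -
    from that obtain k where "(v, w) \<in> edges_minus_root T ^^ k"
      unfolding mem_verts_subtree by (meson rtrancl_imp_relpow)
    from relpow_edges_subtree[OF this, of v] show ?thesis
      by (auto simp: mem_verts_subtree dest: relpow_imp_rtrancl)
  qed
  have "(u, w) \<in> (edges ?S)\<^sup>*" if "u \<in> verts ?S" "w \<in> verts ?S" for u w
    using that reach sym_rtrancl[OF sym] by (meson rtrancl_trans symD)
  moreover have "\<nexists>c. is_cycle (edges ?S) c"
  proof -
    have "edges ?S \<subseteq> edges T"
      using edges_minus_root_subset by (auto simp: edges_subtree)
    with T show ?thesis unfolding rooted_tree_def by (meson is_cycle_mono)
  qed
  moreover have "v \<in> verts ?S"
    by (simp add: mem_verts_subtree)
  moreover have "finite (verts ?S)"
    using verts_subtree_subset[OF T v] T by (auto simp: rooted_tree_def intro: finite_subset)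
  moreover have "edges ?S \<subseteq> verts ?S \<times> verts ?S" "irrefl (edges ?S)"
    using T by (auto simp: edges_subtree edges_minus_root_def rooted_tree_def irrefl_def)
  ultimately show ?thesis
    using sym by (simp add: rooted_tree_def)
qed

text \<open>This is where acyclicity enters: a path between two different children that avoids the root would
  close up to a cycle through the root.\<close>

lemma children_in_same_branch_eq:
  assumes T: "rooted_tree T" and u: "u \<in> children T" and v: "v \<in> children T"
    and uv: "(u, v) \<in> (edges_minus_root T)\<^sup>*"
  shows "u = v"
proof (rule ccontr)
  assume "u \<noteq> v"
  obtain p where p: "p \<noteq> []" "hd p = u" "last p = v" "distinct p"
    "successively (\<lambda>x y. (x, y) \<in> edges_minus_root T) p"
    using rtrancl_imp_distinct_path[OF uv] by blast
  \<comment> \<open>\<open>u \<noteq> v\<close> gives \<open>p\<close> two vertices, hence the closed walk through the root at least three.\<close>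
  have "2 \<le> length p"
    using p \<open>u \<noteq> v\<close> by (cases p rule: remdups_adj.cases) auto
  moreover have "root T \<notin> set p"
  proof
    assume r: "root T \<in> set p"
    then obtain xs ys where xs: "p = xs @ root T # ys"
      by (meson split_list)
    have "root T \<noteq> u" using children_subset[OF T] u by auto
    with p xs have "xs \<noteq> []" by auto
    with p(5) xs show False
      by (auto simp: successively_append_iff edges_minus_root_def)
  qed
  moreover have "successively (\<lambda>x y. (x, y) \<in> edges T) p"
    using p(5) by (rule successively_mono) (auto simp: edges_minus_root_def)
  moreover have "(root T, u) \<in> edges T" "(v, root T) \<in> edges T"
    using T u v by (auto simp: children_def rooted_tree_def sym_def)
  ultimately have "is_cycle (edges T) (root T # p)"
    using p by (auto simp: is_cycle_successively successively_Cons)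
  with T show False by (auto simp: rooted_tree_def)
qed

text \<open>The child is the vertex just before the first visit to the root. The bound \<open>j < k\<close> accounts for
  the final step from that child to the root.\<close>

lemma walk_to_root_enters_through_child:
  assumes T: "rooted_tree T"
  shows "(w, root T) \<in> edges T ^^ k \<Longrightarrow> w \<noteq> root T \<Longrightarrow>
    \<exists>u\<in>children T. \<exists>j<k. (w, u) \<in> edges_minus_root T ^^ j"
proof (induction k arbitrary: w)
  case 0
  then show ?case by simp
next
  case (Suc k)
  obtain y where y: "(w, y) \<in> edges T" "(y, root T) \<in> edges T ^^ k"
    using Suc.prems(1) by (meson relpow_Suc_D2)
  show ?case
  proof (cases "y = root T")
    case True
    with y T have "w \<in> children T"
      by (auto simp: children_def rooted_tree_def sym_def)
    then show ?thesis by (intro bexI[of _ w] exI[of _ 0]) auto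
  next
    case False
    from Suc.IH[OF y(2) False] obtain u j
      where u: "u \<in> children T" "j < k" "(y, u) \<in> edges_minus_root T ^^ j" by blast
    have "(w, y) \<in> edges_minus_root T"
      using y False Suc.prems by (auto simp: edges_minus_root_def)
    with u have "(w, u) \<in> edges_minus_root T ^^ Suc j"
      by (meson relpow_Suc_I2)
    with u show ?thesis by (intro bexI[of _ u] exI[of _ "Suc j"]) auto
  qed
qed

lemma verts_minus_root_eq_UN_branches:
  assumes T: "rooted_tree T"
  shows "verts T - {root T} = (\<Union>v\<in>children T. verts (subtree T v))"
proof
  show "(\<Union>v\<in>children T. verts (subtree T v)) \<subseteq> verts T - {root T}"
    using verts_subtree_subset[OF T] by blast
  show "verts T - {root T} \<subseteq> (\<Union>v\<in>children T. verts (subtree T v))"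
  proof
    fix w assume w: "w \<in> verts T - {root T}"
    then obtain k where "(w, root T) \<in> edges T ^^ k"
      using T unfolding rooted_tree_def by (metis DiffD1 rtrancl_power)
    from walk_to_root_enters_through_child[OF T this] w
    obtain u j where u: "u \<in> children T" "(w, u) \<in> edges_minus_root T ^^ j" by auto
    hence "(w, u) \<in> (edges_minus_root T)\<^sup>*"
      by (meson relpow_imp_rtrancl)
    hence "(u, w) \<in> (edges_minus_root T)\<^sup>*"
      using sym_rtrancl[OF sym_edges_minus_root[OF T]] by (meson symD)
    with u show "w \<in> (\<Union>v\<in>children T. verts (subtree T v))"
      by (auto simp: mem_verts_subtree)
  qed
qed

lemma branches_disjoint:
  assumes T: "rooted_tree T" and "u \<in> children T" "v \<in> children T" "u \<noteq> v"
  shows "verts (subtree T u) \<inter> verts (subtree T v) = {}"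
proof (rule ccontr)
  assume "\<not> ?thesis"
  then obtain w where "(u, w) \<in> (edges_minus_root T)\<^sup>*" "(v, w) \<in> (edges_minus_root T)\<^sup>*"
    by (auto simp: mem_verts_subtree)
  hence "(u, v) \<in> (edges_minus_root T)\<^sup>*"
    using sym_rtrancl[OF sym_edges_minus_root[OF T]] by (meson symD rtrancl_trans)
  from children_in_same_branch_eq[OF T assms(2,3) this] assms(4) show False by simp
qed

text \<open>A walk inside the branch to \<open>v\<close> extends by one step to the root. Conversely, the part of a walk
  to the root before its first visit there ends at a child of the root inside the same branch, and
  this can only be \<open>v\<close>.\<close>

lemma distance_to_root_in_branch:
  assumes T: "rooted_tree T" and v: "v \<in> children T" and w: "w \<in> verts (subtree T v)"
  shows "distance (edges T) w (root T) = Suc (distance (edges (subtree T v)) w v)"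
proof -
  let ?E = "edges T" and ?S = "edges (subtree T v)"
  have "(w, v) \<in> ?S\<^sup>*"
    using rooted_tree_subtree[OF T v] w by (auto simp: rooted_tree_def)
  then obtain k where "(w, v) \<in> ?S ^^ k"
    by (meson rtrancl_imp_relpow)
  hence S: "(w, v) \<in> ?S ^^ distance ?S w v"
    unfolding distance_def by (rule LeastI)
  have "?S \<subseteq> ?E"
    using edges_minus_root_subset by (auto simp: edges_subtree)
  hence "?S ^^ k \<subseteq> ?E ^^ k" for k
    by (induction k) auto
  with S have "(w, v) \<in> ?E ^^ distance ?S w v"
    by blast
  moreover have "(v, root T) \<in> ?E"
    using T v by (auto simp: children_def rooted_tree_def sym_def)
  ultimately have "(w, root T) \<in> ?E ^^ Suc (distance ?S w v)"
    by auto
  then show ?thesis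
    unfolding distance_def[of ?E]
  proof (rule Least_equality)
    fix k assume k: "(w, root T) \<in> ?E ^^ k"
    have "w \<noteq> root T" using verts_subtree_subset[OF T v] w by auto
    from walk_to_root_enters_through_child[OF T k this] obtain u j
      where u: "u \<in> children T" "j < k" "(w, u) \<in> edges_minus_root T ^^ j" by blast
    have "(v, u) \<in> (edges_minus_root T)\<^sup>*"
      using w u(3) by (auto simp: mem_verts_subtree dest: relpow_imp_rtrancl)
    hence "u = v" using children_in_same_branch_eq[OF T v u(1)] by simp
    with u(3) w have "(w, v) \<in> ?S ^^ j"
      using relpow_edges_subtree by fastforce
    hence "distance ?S w v \<le> j"
      unfolding distance_def by (rule Least_le)
    with u(2) show "Suc (distance ?S w v) \<le> k" by simp
  qed
qed

text \<open>The sum over the non-root vertices splits along the branches. In the branch of \<open>v\<close> all distances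
  drop by one when measured from \<open>v\<close>, which takes out a factor \<open>x\<close>; the vertex \<open>v\<close> itself,
  at distance \<open>0\<close>, is left out of the polynomial of the branch and gives the separate term \<open>x\<close>.\<close>

lemma PWP_tree_eq_sum_children:
  assumes T: "rooted_tree T"
  shows "PWP_tree T = (\<Sum>v\<in>children T. monom 1 1 + monom 1 1 * PWP_tree (subtree T v))"
proof -
  have fin: "finite (verts (subtree T v))" if "v \<in> children T" for v
    using rooted_tree_subtree[OF T that] by (simp add: rooted_tree_def)
  have branch: "(\<Sum>w\<in>verts (subtree T v). monom 1 (distance (edges T) w (root T))) =
      monom 1 1 + monom 1 1 * PWP_tree (subtree T v)" if v: "v \<in> children T" for v
  proof -
    let ?S = "subtree T v"
    have "(\<Sum>w\<in>verts ?S. monom 1 (distance (edges T) w (root T))) =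
        (\<Sum>w\<in>verts ?S. monom 1 1 * monom (1::int) (distance (edges ?S) w v))"
      by (intro sum.cong) (simp_all add: distance_to_root_in_branch[OF T v] mult_monom)
    also have "\<dots> = monom 1 1 * (\<Sum>w\<in>verts ?S. monom 1 (distance (edges ?S) w v))"
      by (simp add: sum_distrib_left)
    also have "(\<Sum>w\<in>verts ?S. monom (1::int) (distance (edges ?S) w v)) =
        monom 1 (distance (edges ?S) v v) + PWP_tree ?S"
      unfolding PWP_tree_def partial_wiener_poly_def root_subtree
      by (rule sum.remove) (use fin[OF v] in \<open>auto simp: mem_verts_subtree\<close>)
    also have "distance (edges ?S) v v = 0"
      unfolding distance_def by (rule Least_eq_0) simp
    finally show ?thesis by (simp add: algebra_simps)
  qed
  have "PWP_tree T = (\<Sum>v\<in>children T. \<Sum>w\<in>verts (subtree T v).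
      monom 1 (distance (edges T) w (root T)))"
    unfolding PWP_tree_def partial_wiener_poly_def verts_minus_root_eq_UN_branches[OF T]
    using branches_disjoint[OF T] fin finite_children[OF T]
    by (intro sum.UNION_disjoint) auto
  thus ?thesis by (simp add: branch)
qed


section \<open>Indices of primes and the additive function\<close>

lemma bij_betw_nth_prime: "bij_betw nth_prime {1..} {p. prime p}"
proof -
  have "bij_betw (\<lambda>m::nat. m - 1) {1..} UNIV"
    by (rule bij_betwI[of _ _ _ Suc]) auto
  from bij_betw_trans[OF this bij_enumerate[OF primes_infinite]]
  show ?thesis by (simp add: nth_prime_def[abs_def] comp_def)
qed

lemma prime_nth_prime: "1 \<le> m \<Longrightarrow> prime (nth_prime m)"
  using bij_betw_apply[OF bij_betw_nth_prime] by simp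

text \<open>Makes recursion on indices of prime factors terminate. At \<open>0\<close> the bound holds because truncated
  subtraction makes \<open>nth_prime 0\<close> equal to \<open>nth_prime 1\<close>.\<close>

lemma less_nth_prime: "m < nth_prime m"
proof (induction m)
  case 0
  have "nth_prime 0 = nth_prime 1"
    by (simp only: nth_prime_def diff_0_eq_0 diff_self_eq_0)
  then show ?case using prime_nth_prime[of 1] by (simp add: prime_gt_0_nat)
next
  case (Suc m)
  show ?case
  proof (cases m)
    case 0
    then show ?thesis using prime_gt_1_nat[OF prime_nth_prime[of 1]] by simp
  next
    case (Suc k)
    have "nth_prime m < nth_prime (Suc m)"
      unfolding nth_prime_def Suc diff_Suc_1 by (rule enumerate_step[OF primes_infinite])
    with Suc.IH show ?thesis by simp
  qed
qed

definition prime_index :: "nat \<Rightarrow> nat" where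
  "prime_index = the_inv_into {1..} nth_prime"

lemma prime_index_nth_prime [simp]: "1 \<le> m \<Longrightarrow> prime_index (nth_prime m) = m"
  unfolding prime_index_def
  by (rule the_inv_into_f_f[OF bij_betw_imp_inj_on[OF bij_betw_nth_prime]]) simp

lemma nth_prime_prime_index [simp]: "prime p \<Longrightarrow> nth_prime (prime_index p) = p"
  unfolding prime_index_def
  by (rule f_the_inv_into_f_bij_betw[OF bij_betw_nth_prime]) auto

lemma prime_index_ge_1: "prime p \<Longrightarrow> 1 \<le> prime_index p"
  using bij_betw_apply[OF bij_betw_the_inv_into[OF bij_betw_nth_prime], of p]
  by (simp add: prime_index_def)

lemma prime_index_less: "p \<in># prime_factorization n \<Longrightarrow> prime_index p < n"
proof -
  assume p: "p \<in># prime_factorization n"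
  hence "prime p" "p dvd n" "n \<noteq> 0" by (auto simp: in_prime_factors_iff)
  hence "p \<le> n" by (auto dest: dvd_imp_le)
  moreover have "prime_index p < p"
    using less_nth_prime[of "prime_index p"] \<open>prime p\<close> by simp
  ultimately show ?thesis by simp
qed

text \<open>The recurrence of the theorem read off from the complete prime factorization at once. In this form
  independence of the chosen factorization \<open>n = r s\<close> needs no argument.\<close>

function arith_PWP :: "nat \<Rightarrow> int poly" where
  "arith_PWP n =
     (\<Sum>p\<in>#prime_factorization n. monom 1 1 + monom 1 1 * arith_PWP (prime_index p))"
  by auto
termination
  by (relation "measure id") (auto dest: prime_index_less)

declare arith_PWP.simps [simp del]

lemma arith_PWP_1: "arith_PWP (Suc 0) = 0"
  by (simp add: arith_PWP.simps[of "Suc 0"])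

lemma arith_PWP_nth_prime:
  "1 \<le> t \<Longrightarrow> arith_PWP (nth_prime t) = monom 1 1 + monom 1 1 * arith_PWP t"
  by (simp add: arith_PWP.simps[of "nth_prime t"] prime_factorization_prime prime_nth_prime)

lemma arith_PWP_mult:
  "r \<noteq> 0 \<Longrightarrow> s \<noteq> 0 \<Longrightarrow> arith_PWP (r * s) = arith_PWP r + arith_PWP s"
  by (simp add: arith_PWP.simps[of "r * s"] arith_PWP.simps[of r] arith_PWP.simps[of s]
      prime_factorization_mult)

lemma arith_PWP_prod:
  "finite A \<Longrightarrow> (\<And>a. a \<in> A \<Longrightarrow> f a \<noteq> 0) \<Longrightarrow> arith_PWP (prod f A) = (\<Sum>a\<in>A. arith_PWP (f a))"
  by (induction A rule: finite_induct) (simp_all add: arith_PWP_1 arith_PWP_mult)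

section \<open>The polynomial as a function of the Matula number\<close>

lemma matula_pos: "rooted_tree T \<Longrightarrow> 1 \<le> matula T"
proof (induction T rule: matula.induct)
  case (1 T)
  have "prime (nth_prime (matula (subtree T v)))" if "v \<in> children T" for v
    using 1 that by (intro prime_nth_prime) (auto intro: rooted_tree_subtree)
  hence "(\<Prod>v\<in>children T. nth_prime (matula (subtree T v))) > 0"
    by (intro prod_pos) (auto simp: prime_gt_0_nat)
  then show ?case using 1 by (simp add: matula.simps[of T])
qed

text \<open>The prime factors of \<open>matula T\<close> are indexed by the Matula numbers of the branches, so both sides
  satisfy the same recursion over the children of the root.\<close>

lemma PWP_tree_eq_arith_PWP: "rooted_tree T \<Longrightarrow> PWP_tree T = arith_PWP (matula T)"
proof (induction T rule: matula.induct)
  case (1 T)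
  note T = \<open>rooted_tree T\<close>
  have pos: "1 \<le> matula (subtree T v)" if "v \<in> children T" for v
    using matula_pos[OF rooted_tree_subtree[OF T that]] .
  have "arith_PWP (matula T) = arith_PWP (\<Prod>v\<in>children T. nth_prime (matula (subtree T v)))"
    using T by (simp add: matula.simps[of T])
  also have "\<dots> = (\<Sum>v\<in>children T. arith_PWP (nth_prime (matula (subtree T v))))"
    by (intro arith_PWP_prod finite_children[OF T]) (simp add: prime_nth_prime[OF pos] prime_gt_0_nat)
  also have "\<dots> = (\<Sum>v\<in>children T. monom 1 1 + monom 1 1 * PWP_tree (subtree T v))"
    using 1 pos rooted_tree_subtree[OF T] by (intro sum.cong) (simp_all add: arith_PWP_nth_prime)
  finally show ?case using PWP_tree_eq_sum_children[OF T] by simp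
qed

section \<open>Renaming vertices\<close>

definition map_graph :: "('a \<Rightarrow> 'b) \<Rightarrow> 'a rooted_graph \<Rightarrow> 'b rooted_graph" where
  "map_graph f T =
     \<lparr>verts = f ` verts T, edges = map_prod f f ` edges T, root = f (root T)\<rparr>"

lemma map_graph_sel [simp]:
  "verts (map_graph f T) = f ` verts T"
  "edges (map_graph f T) = map_prod f f ` edges T"
  "root (map_graph f T) = f (root T)"
  by (simp_all add: map_graph_def)

lemma map_prod_image_iff:
  assumes "inj f"
  shows "(f a, y) \<in> map_prod f f ` E \<longleftrightarrow> (\<exists>b. y = f b \<and> (a, b) \<in> E)"
proof
  assume "(f a, y) \<in> map_prod f f ` E"
  then show "\<exists>b. y = f b \<and> (a, b) \<in> E"
    using assms by (auto simp: inj_eq)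
qed force

lemma rtrancl_map_prod_image_iff:
  assumes "inj f"
  shows "(f a, y) \<in> (map_prod f f ` E)\<^sup>* \<longleftrightarrow> (\<exists>b. y = f b \<and> (a, b) \<in> E\<^sup>*)"
proof
  assume "(f a, y) \<in> (map_prod f f ` E)\<^sup>*"
  then show "\<exists>b. y = f b \<and> (a, b) \<in> E\<^sup>*"
  proof (induction rule: rtrancl_induct)
    case base
    then show ?case by blast
  next
    case (step y z)
    then show ?case
      using \<open>inj f\<close> by (auto simp: inj_eq)
  qed
next
  assume "\<exists>b. y = f b \<and> (a, b) \<in> E\<^sup>*"
  then obtain b where b: "y = f b" "(a, b) \<in> E\<^sup>*" by blast
  from b(2) have "(f a, f b) \<in> (map_prod f f ` E)\<^sup>*"
  proof (induction rule: rtrancl_induct)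
    case base
    then show ?case by blast
  next
    case (step y z)
    then have "(f y, f z) \<in> map_prod f f ` E" by force
    with step show ?case by (meson rtrancl.rtrancl_into_rtrancl)
  qed
  with b show "(f a, y) \<in> (map_prod f f ` E)\<^sup>*" by simp
qed

lemma is_cycle_map:
  assumes "is_cycle E c" "inj_on g (set c)"
    and "\<And>a b. a \<in> set c \<Longrightarrow> b \<in> set c \<Longrightarrow> (a, b) \<in> E \<Longrightarrow> (g a, g b) \<in> E'"
  shows "is_cycle E' (map g c)"
proof -
  have "c \<noteq> []" using assms(1) by (auto simp: is_cycle_def)
  with assms show ?thesis
    by (auto simp: is_cycle_def distinct_map last_map hd_map)
qed

lemma set_cycle_subset_Domain: "is_cycle E c \<Longrightarrow> set c \<subseteq> Domain E"
proof
  fix x assume c: "is_cycle E c" and "x \<in> set c"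
  then obtain i where i: "i < length c" "x = c ! i" by (auto simp: in_set_conv_nth)
  show "x \<in> Domain E"
  proof (cases "Suc i < length c")
    case True
    then show ?thesis using c i by (auto simp: is_cycle_def)
  next
    case False
    with i have "c \<noteq> []" "i = length c - 1" by auto
    hence "c ! i = last c" by (simp add: last_conv_nth)
    then show ?thesis using c i by (auto simp: is_cycle_def)
  qed
qed

lemma rooted_tree_map_graph:
  assumes f: "inj f" and T: "rooted_tree T"
  shows "rooted_tree (map_graph f T)"
proof -
  have "\<not> is_cycle (map_prod f f ` edges T) c" for c
  proof
    assume c: "is_cycle (map_prod f f ` edges T) c"
    have "set c \<subseteq> range f"
      using set_cycle_subset_Domain[OF c] by auto
    with f have "is_cycle (edges T) (map (inv f) c)"
      by (intro is_cycle_map[OF c] inj_on_inv_into) (auto simp: inv_f_f)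
    with T show False by (auto simp: rooted_tree_def)
  qed
  moreover have "sym (map_prod f f ` edges T)"
    using T by (force simp: rooted_tree_def sym_def)
  ultimately show ?thesis
    using T f unfolding rooted_tree_def
    by (auto simp: rtrancl_map_prod_image_iff irrefl_def inj_eq)
qed

lemma children_map_graph: "inj f \<Longrightarrow> children (map_graph f T) = f ` children T"
  by (auto simp: children_def map_prod_image_iff)

lemma subtree_map_graph:
  assumes f: "inj f"
  shows "subtree (map_graph f T) (f v) = map_graph f (subtree T v)"
proof -
  have E: "edges_minus_root (map_graph f T) = map_prod f f ` edges_minus_root T"
    using f by (auto simp: edges_minus_root_def inj_eq)
  have "verts (subtree (map_graph f T) (f v)) = f ` verts (subtree T v)"
    using f by (auto simp: mem_verts_subtree E rtrancl_map_prod_image_iff)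
  moreover from this have "edges (subtree (map_graph f T) (f v)) =
      map_prod f f ` edges (subtree T v)"
    using f by (auto simp: edges_subtree E inj_eq)
  ultimately show ?thesis
    by (intro rooted_graph.equality) simp_all
qed

text \<open>An injective renaming maps children to children and branches to branches, so the two products
  agree factor by factor.\<close>

lemma matula_map_graph:
  assumes f: "inj f"
  shows "rooted_tree T \<Longrightarrow> matula (map_graph f T) = matula T"
proof (induction T rule: matula.induct)
  case (1 T)
  have "matula (map_graph f T) =
      (\<Prod>v\<in>f ` children T. nth_prime (matula (subtree (map_graph f T) v)))"
    using 1 f by (simp add: matula.simps[of "map_graph f T"] rooted_tree_map_graph
        children_map_graph)
  also have "\<dots> = (\<Prod>v\<in>children T. nth_prime (matula (map_graph f (subtree T v))))"
    using f by (subst prod.reindex) (auto intro: inj_on_subset simp: subtree_map_graph)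
  also have "\<dots> = (\<Prod>v\<in>children T. nth_prime (matula (subtree T v)))"
    using 1 by (intro prod.cong) (auto simp: rooted_tree_subtree)
  finally show ?case using 1 by (simp add: matula.simps[of T])
qed

section \<open>Every positive integer is a Matula number\<close>

text \<open>A new root joined to the roots of the trees \<open>T i\<close>. Tagging each vertex with its index keeps
  the trees disjoint, even when the same tree occurs for several indices, as it must for a repeated
  prime factor; \<open>None\<close> is the new root.\<close>

definition graft :: "'i set \<Rightarrow> ('i \<Rightarrow> 'a rooted_graph) \<Rightarrow> ('i \<times> 'a) option rooted_graph" where
  "graft I T =
     \<lparr>verts = insert None {Some (i, a) |i a. i \<in> I \<and> a \<in> verts (T i)},
      edges = {(Some (i, a), Some (i, b)) |i a b. i \<in> I \<and> (a, b) \<in> edges (T i)} \<union>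
        (\<Union>i\<in>I. {(None, Some (i, root (T i))), (Some (i, root (T i)), None)}),
      root = None\<rparr>"

lemma graft_sel [simp]:
  "verts (graft I T) = insert None {Some (i, a) |i a. i \<in> I \<and> a \<in> verts (T i)}"
  "root (graft I T) = None"
  by (simp_all add: graft_def)

lemma edges_graft [simp]:
  "(Some (i, a), Some (j, b)) \<in> edges (graft I T) \<longleftrightarrow> i = j \<and> i \<in> I \<and> (a, b) \<in> edges (T i)"
  "(None, Some (i, a)) \<in> edges (graft I T) \<longleftrightarrow> i \<in> I \<and> a = root (T i)"
  "(Some (i, a), None) \<in> edges (graft I T) \<longleftrightarrow> i \<in> I \<and> a = root (T i)"
  "(None, None) \<notin> edges (graft I T)"
  by (auto simp: graft_def)

lemma walk_in_graft_stays_in_branch: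
  assumes "successively (\<lambda>x y. (x, y) \<in> edges (graft I T)) c" "None \<notin> set c" "c \<noteq> []"
  shows "\<exists>i. set c \<subseteq> {Some (i, a) |a. True}"
  using assms
proof (induction c)
  case Nil
  then show ?case by simp
next
  case (Cons x c)
  then obtain j a where x: "x = Some (j, a)" by (cases x) auto
  show ?case
  proof (cases c)
    case Nil
    then show ?thesis using x by auto
  next
    case (Cons y c')
    with Cons.IH Cons.prems obtain i where i: "set c \<subseteq> {Some (i, a) |a. True}"
      by (auto simp: successively_Cons)
    with Cons obtain b where y: "y = Some (i, b)" by auto
    have "(x, y) \<in> edges (graft I T)"
      using Cons.prems Cons by (simp add: successively_Cons)
    with x y have "i = j" by simp
    with i x show ?thesis by auto
  qed
qed

text \<open>A cycle that avoids the new root stays in one tree and is a cycle there. A cycle through the new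
  root leaves it and returns to it through the same tree, hence through the same vertex, which is
  impossible since a cycle has at least three vertices.\<close>

lemma no_cycle_graft:
  assumes T: "\<And>i. i \<in> I \<Longrightarrow> rooted_tree (T i)"
  shows "\<not> is_cycle (edges (graft I T)) c"
proof
  assume c: "is_cycle (edges (graft I T)) c"
  show False
  proof (cases "None \<in> set c")
    case False
    with c obtain i where i: "set c \<subseteq> {Some (i, a) |a. True}"
      using walk_in_graft_stays_in_branch[of I T c] by (force simp: is_cycle_successively)
    let ?g = "\<lambda>x. snd (the x)"
    have g: "Some (i, ?g x) = x" if "x \<in> set c" for x
      using i that by force
    have "is_cycle (edges (T i)) (map ?g c)"
    proof (rule is_cycle_map[OF c])
      show "inj_on ?g (set c)"
        by (rule inj_on_inverseI[of _ "\<lambda>a. Some (i, a)"]) (rule g)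
      show "(?g x, ?g y) \<in> edges (T i)"
        if "x \<in> set c" "y \<in> set c" "(x, y) \<in> edges (graft I T)" for x y
        using that(3) edges_graft(1)[of i "?g x" i "?g y" I T] by (simp only: g that) simp
    qed
    moreover have "i \<in> I"
    proof -
      have "c \<noteq> []" using c by (auto simp: is_cycle_def)
      then have "last c \<in> set c" "hd c \<in> set c" by auto
      with i obtain a b where "last c = Some (i, a)" "hd c = Some (i, b)" by blast
      with c show ?thesis by (simp add: is_cycle_def)
    qed
    ultimately show False using T by (auto simp: rooted_tree_def)
  next
    case True
    \<comment> \<open>Rotate the cycle so that it starts at the new root.\<close>
    then obtain xs ys where "c = xs @ None # ys" by (meson split_list)
    with c is_cycle_rotate[of _ xs "None # ys"]
    obtain p where p: "is_cycle (edges (graft I T)) (None # p)" by auto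
    hence ne: "p \<noteq> []" "2 \<le> length p" "distinct p" "None \<notin> set p"
      "successively (\<lambda>x y. (x, y) \<in> edges (graft I T)) p"
      by (auto simp: is_cycle_successively successively_Cons)
    from walk_in_graft_stays_in_branch[OF ne(5,4,1)]
    obtain i where i: "set p \<subseteq> {Some (i, a) |a. True}" ..
    from ne(1) have "hd p \<in> set p" "last p \<in> set p" by auto
    with i obtain a b where ab: "hd p = Some (i, a)" "last p = Some (i, b)" by blast
    with p ne have "a = root (T i)" "b = root (T i)"
      by (auto simp: is_cycle_successively successively_Cons)
    with ab have "hd p = last p" by simp
    with ne show False
      by (cases p) (auto split: if_splits)
  qed
qed

lemma rooted_tree_graft:
  assumes I: "finite I" and T: "\<And>i. i \<in> I \<Longrightarrow> rooted_tree (T i)"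
  shows "rooted_tree (graft I T)"
proof -
  let ?G = "graft I T"
  have "verts ?G = insert None (\<Union>i\<in>I. (\<lambda>a. Some (i, a)) ` verts (T i))"
    by auto
  hence fin: "finite (verts ?G)"
    using I T by (auto simp: rooted_tree_def)
  have sub: "edges ?G \<subseteq> verts ?G \<times> verts ?G"
    using T by (force simp: graft_def rooted_tree_def)
  have sym: "sym (edges ?G)"
  proof (rule symI)
    fix x y assume xy: "(x, y) \<in> edges ?G"
    have "(a, b) \<in> edges (T i) \<longleftrightarrow> (b, a) \<in> edges (T i)" if "i \<in> I" for i a b
      using T[OF that] by (auto simp: rooted_tree_def dest: symD)
    with xy show "(y, x) \<in> edges ?G"
      by (cases x; cases y) auto
  qed
  have irr: "irrefl (edges ?G)"
  proof (rule irreflI)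
    fix x
    have "(a, a) \<notin> edges (T i)" if "i \<in> I" for i a
      using T[OF that] by (auto simp: rooted_tree_def irrefl_def)
    then show "(x, x) \<notin> edges ?G"
      by (cases x) auto
  qed
  have "(None, x) \<in> (edges ?G)\<^sup>*" if x: "x \<in> verts ?G" for x
  proof (cases x)
    case None
    then show ?thesis by simp
  next
    case (Some y)
    then obtain i a where y: "x = Some (i, a)" "i \<in> I" "a \<in> verts (T i)"
      using x by auto
    hence "(root (T i), a) \<in> (edges (T i))\<^sup>*"
      using T by (auto simp: rooted_tree_def)
    hence "(None, Some (i, a)) \<in> (edges ?G)\<^sup>*"
    proof (induction rule: rtrancl_induct)
      case base
      then show ?case using y by (intro r_into_rtrancl) simp
    next
      case (step b c)
      then have "(Some (i, b), Some (i, c)) \<in> edges ?G" using y by simp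
      with step show ?case by (meson rtrancl.rtrancl_into_rtrancl)
    qed
    with y show ?thesis by simp
  qed
  hence "\<forall>x\<in>verts ?G. \<forall>y\<in>verts ?G. (x, y) \<in> (edges ?G)\<^sup>*"
    using sym_rtrancl[OF sym] by (meson rtrancl_trans symD)
  with fin sub sym irr no_cycle_graft[of I T] T show ?thesis
    unfolding rooted_tree_def by auto
qed

lemma inj_Some_Pair: "inj (\<lambda>a. Some (i, a))"
  by (simp add: inj_def)

text \<open>Without the new root, the component of the root of \<open>T i\<close> is all of the copy of \<open>T i\<close>: tags do
  not change along the remaining edges, and \<open>T i\<close> is connected.\<close>

lemma subtree_graft:
  assumes i: "i \<in> I" and T: "rooted_tree (T i)"
  shows "subtree (graft I T) (Some (i, root (T i))) = map_graph (\<lambda>a. Some (i, a)) (T i)"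
proof -
  let ?f = "\<lambda>a. Some (i, a)" and ?G = "graft I T" and ?r = "root (T i)"
  have E: "edges_minus_root ?G =
      {(Some (j, a), Some (j, b)) |j a b. j \<in> I \<and> (a, b) \<in> edges (T j)}"
    by (auto simp: edges_minus_root_def graft_def)
  have V: "verts (subtree ?G (?f ?r)) = ?f ` verts (T i)"
  proof safe
    fix x assume "x \<in> verts (subtree ?G (?f ?r))"
    hence "(?f ?r, x) \<in> (edges_minus_root ?G)\<^sup>*" by (simp add: mem_verts_subtree)
    thus "x \<in> ?f ` verts (T i)"
      by (induction rule: rtrancl_induct) (use T in \<open>auto simp: E rooted_tree_def\<close>)
  next
    fix a assume "a \<in> verts (T i)"
    hence "(?r, a) \<in> (edges (T i))\<^sup>*" using T by (auto simp: rooted_tree_def)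
    hence "(?f ?r, ?f a) \<in> (map_prod ?f ?f ` edges (T i))\<^sup>*"
      by (simp add: rtrancl_map_prod_image_iff[OF inj_Some_Pair])
    moreover have "map_prod ?f ?f ` edges (T i) \<subseteq> edges_minus_root ?G"
      using i by (auto simp: E)
    ultimately show "?f a \<in> verts (subtree ?G (?f ?r))"
      unfolding mem_verts_subtree by (meson rtrancl_mono subsetD)
  qed
  have "edges (subtree ?G (?f ?r)) = map_prod ?f ?f ` edges (T i)"
    using T i by (force simp: edges_subtree V E rooted_tree_def)
  with V show ?thesis by (intro rooted_graph.equality) simp_all
qed

lemma matula_graft:
  assumes I: "finite I" and T: "\<And>i. i \<in> I \<Longrightarrow> rooted_tree (T i)"
  shows "matula (graft I T) = (\<Prod>i\<in>I. nth_prime (matula (T i)))"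
proof -
  let ?c = "\<lambda>i. Some (i, root (T i))"
  have "children (graft I T) = ?c ` I"
    by (auto simp: children_def graft_def)
  hence "matula (graft I T) = (\<Prod>v\<in>?c ` I. nth_prime (matula (subtree (graft I T) v)))"
    using rooted_tree_graft[of I T] I T by (simp add: matula.simps[of "graft I T"])
  also have "\<dots> = (\<Prod>i\<in>I. nth_prime (matula (subtree (graft I T) (?c i))))"
    by (subst prod.reindex) (auto simp: inj_on_def)
  also have "\<dots> = (\<Prod>i\<in>I. nth_prime (matula (T i)))"
    using T by (intro prod.cong) (simp_all add: subtree_graft matula_map_graph[OF inj_Some_Pair])
  finally show ?thesis .
qed

text \<open>By strong induction there are trees whose Matula numbers are the indices of the prime factors of
  \<open>n\<close>, since an index is smaller than its prime. The factors are taken as a list so that its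
  positions index them with multiplicity.\<close>

lemma matula_surj:
  assumes "1 \<le> n"
  shows "\<exists>T :: nat rooted_graph. rooted_tree T \<and> matula T = n"
  using assms
proof (induction n rule: less_induct)
  case (less n)
  obtain ps where ps: "mset ps = prime_factorization n"
    using ex_mset by blast
  have prime: "prime (ps ! i)" and "prime_index (ps ! i) < n" if "i < length ps" for i
  proof -
    have "ps ! i \<in># prime_factorization n"
      using that ps by (metis nth_mem_mset)
    then show "prime (ps ! i)" "prime_index (ps ! i) < n"
      by (auto intro: prime_index_less)
  qed
  hence "\<forall>i<length ps. \<exists>T :: nat rooted_graph. rooted_tree T \<and> matula T = prime_index (ps ! i)"
    using less.IH prime_index_ge_1 by blast
  then obtain T :: "nat \<Rightarrow> nat rooted_graph" where
    T: "\<And>i. i < length ps \<Longrightarrow> rooted_tree (T i) \<and> matula (T i) = prime_index (ps ! i)"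
    by metis
  let ?G = "graft {..<length ps} T"
  have "matula ?G = (\<Prod>i<length ps. ps ! i)"
    using T prime by (subst matula_graft) (auto intro!: prod.cong)
  also have "\<dots> = prod_mset (prime_factorization n)"
    by (simp flip: ps add: prod_mset_prod_list prod.list_conv_set_nth atLeast0LessThan)
  also have "\<dots> = n"
    using less.prems by (simp add: prod_mset_prime_factorization_nat)
  finally have "matula ?G = n" .
  moreover have "rooted_tree ?G"
    using T by (intro rooted_tree_graft) auto
  \<comment> \<open>The vertices of the grafted tree are countable, which brings them back to natural numbers.\<close>
  ultimately have "rooted_tree (map_graph to_nat ?G) \<and> matula (map_graph to_nat ?G) = n"
    by (simp add: rooted_tree_map_graph matula_map_graph)
  then show ?case by blast
qed

lemma PWP_eq_arith_PWP:
  assumes "1 \<le> n"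
  shows "PWP n = arith_PWP n"
proof -
  have "rooted_tree (\<tau> n) \<and> matula (\<tau> n) = n"
    unfolding \<tau>_def using matula_surj[OF assms] by (rule someI_ex)
  then show ?thesis
    unfolding PWP_def using PWP_tree_eq_arith_PWP by metis
qed

theorem proposition3p25:
  fixes n :: nat
  assumes "n \<ge> 1"
  shows "(n = 1 \<longrightarrow> PWP n = 0) \<and>
         (\<forall>t\<ge>1. n = nth_prime t \<longrightarrow> PWP n = monom 1 1 + monom 1 1 * PWP t) \<and>
         (\<forall>r s. r \<ge> 2 \<and> s \<ge> 2 \<and> n = r * s \<longrightarrow> PWP n = PWP r + PWP s)"
  using assms arith_PWP_1 arith_PWP_nth_prime arith_PWP_mult
  by (auto simp: PWP_eq_arith_PWP)

end
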